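(* Let $(X,d)$ be a metric space, $Y$ a real Hausdorff topological vector space, $K\subset Y$ a proper convex cone, and $H\subset K\setminus(-K)$ a nonempty set such that $H+K$ is convex. Let $\mathcal{A}\subseteq X\times 2^Y$ be nonempty with $A\ne\emptyset$ for every $(x,A)\in\mathcal{A}$; put $\mathcal{A}_2:=\{A\in2^Y\mid \exists x\in X:(x,A)\in\mathcal{A}\}$ and $Y_{\mathcal{A}}:=\bigcup\mathcal{A}_2$. Assume that for every $\preceq_H$-decreasing sequence $((x_n,A_n))_{n\ge1}\subset\mathcal{A}$ with $(x_n)$ Cauchy there exists $(x,A)\in\mathcal{A}$ with $(x,A)\preceq_H(x_n,A_n)$ for all $n\ge1$. Assume also that one of the following conditions holds: (i) either (a) $0\notin\operatorname{cl}_{seq}(H+K)$ and $Y_{\mathcal{A}}$ is quasi $K$-bounded, or (b) $0\notin\operatorname{cl}(H+K)$ and $Y_{\mathcal{A}}$ is $K$-bounded; (ii) there exists $z^*\in K^+$ such that $\inf z^*(H)>0$ and $\inf z^*(Y_{\mathcal{A}})>-\infty$; (iii) for every sequence $(h_n)\subseteq H$ there exists $z^*\in K^+$ with $\limsup z^*(h_n)>0$, and $Y_{\mathcal{A}}$ is $K^+$-bounded; (iv) $H$ is sequentially compact, and there exist a bounded set $B\subset Y$ and a convex cone $C\subset Y$ such that $K\subset C$, $H\subset\operatorname{int}C$, and $B\not\subset A+C$ for every $A\in\mathcal{A}_2$. Then for every $(x,A)\in\mathcal{A}$ there exists $(\overline{x},\overline{A})\in\mathcal{A}$ such that $(\overline{x},\overline{A})\preceq_H(x,A)$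 and, for every $(x',A')\in\mathcal{A}$, $(x',A')\preceq_H(\overline{x},\overline{A})$ implies $x'=\overline{x}$. Moreover, in case (ii), $(\overline{x},\overline{A})$ can be taken to be minimal in $\mathcal{A}$ with respect to $\preceq_{H,z^*}$ and such that $(\overline{x},\overline{A})\preceq_{H,z^*}(x,A)$.
   Context: A proper convex cone $K$ satisfies $0\in K$, $K+K\subset K$, $tK\subset K$ for $t\ge0$, and $\{0\}\ne K\ne Y$. $K^+=\{y^*\in Y^*\mid y^*(y)\ge0\ \forall y\in K\}$, $Y^*$ being the topological dual. Sums of sets are Minkowski sums with $\emptyset+A=\emptyset$; $\inf\emptyset=+\infty$. The preorder $\preceq_H$ on $X\times2^Y$: $(x_1,A_1)\preceq_H(x_2,A_2)\iff A_2\subset A_1+d(x_1,x_2)H+K$. For $z^*\in K^+$, $(x_1,A_1)\preceq_{H,z^*}(x_2,A_2)$ iff either $(x_1,A_1)=(x_2,A_2)$, or $(x_1,A_1)\preceq_H(x_2,A_2)$ and $\inf z^*(A_1)<\inf z^*(A_2)$. A sequence $(w_n)_{n\ge1}$ is $\preceq$-decreasing if $w_{n+1}\preceq w_n$ for all $n$; $w$ is minimal in $\mathcal{A}$ if $w'\in\mathcal{A}$, $w'\preceq w$ imply $w'=w$. For $E\subset Y$: $\operatorname{cl}_{seq}E$ is the set of limits of convergent sequences from $E$; $E$ is sequentially compact if every sequence in $E$ has a subsequence converging to an element of $E$; $E$ is quasi $K$-bounded if $E\subset B+K$ for some bounded $B\subset Y$; $E$ is $K$-bounded if for every neighborhood $U$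 of $0$ there is $\lambda>0$ with $E\subset\lambda U+K$; $E$ is $K^+$-bounded if $y^*(E)$ is bounded from below for every $y^*\in K^+$. *)

theory Defs
  imports "HOL-Analysis.Analysis"
begin

text \<open>Real Hausdorff topological vector spaces. Joint continuity of scalar multiplication is stated
  in the same filter style as \<open>tendsto_add_Pair\<close>; neither local convexity nor first
  countability is assumed.\<close>

class hausdorff_tvs = real_vector + topological_ab_group_add + t2_space +
  assumes tendsto_scaleR_Pair:
    "LIM p (nhds c \<times>\<^sub>F nhds y). fst p *\<^sub>R snd p :> nhds (c *\<^sub>R y)"

instance real_normed_vector \<subseteq> hausdorff_tvs
proof
  fix c :: real and y :: 'a
  have "(fst \<longlongrightarrow> c) (nhds c \<times>\<^sub>F nhds y)" "(snd \<longlongrightarrow> y) (nhds c \<times>\<^sub>F nhds y)"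
    by (auto intro: filterlim_fst filterlim_snd)
  then show "LIM p (nhds c \<times>\<^sub>F nhds y). fst p *\<^sub>R snd p :> nhds (c *\<^sub>R y)"
    by (rule tendsto_scaleR)
qed

text \<open>By \<open>convex_cone_iff\<close>, the library's convex cones contain 0 and are closed under
  addition and under multiplication by nonnegative reals.\<close>

definition proper_convex_cone :: "'b::real_vector set \<Rightarrow> bool" where
  "proper_convex_cone K \<longleftrightarrow> convex_cone K \<and> K \<noteq> {0} \<and> K \<noteq> UNIV"

definition topological_dual :: "('b::hausdorff_tvs \<Rightarrow> real) set" where
  "topological_dual = {f. linear f \<and> continuous_on UNIV f}"

definition dual_cone :: "'b::hausdorff_tvs set \<Rightarrow> ('b \<Rightarrow> real) set" where
  "dual_cone K = {f \<in> topological_dual. \<forall>y\<in>K. f y \<ge> 0}"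

text \<open>Infimum of a functional over a set, in the extended reals; it is \<open>\<infinity>\<close> on the empty set.\<close>

definition inf_over :: "('b \<Rightarrow> real) \<Rightarrow> 'b set \<Rightarrow> ereal" where
  "inf_over f A = (INF y\<in>A. ereal (f y))"

text \<open>Sums of sets are the Minkowski sums of \<open>HOL-Library.Set_Algebras\<close>. Unary minus on sets is
  complement in HOL, so the reflection of \<open>K\<close> is always written \<open>uminus ` K\<close>.\<close>

definition preceq_H :: "'b::real_vector set \<Rightarrow> 'b set \<Rightarrow>
    'a::metric_space \<times> 'b set \<Rightarrow> 'a \<times> 'b set \<Rightarrow> bool" where
  "preceq_H H K w1 w2 \<longleftrightarrow>
     snd w2 \<subseteq> snd w1 + (\<lambda>h. dist (fst w1) (fst w2) *\<^sub>R h) ` H + K"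

definition preceq_Hz :: "'b::real_vector set \<Rightarrow> 'b set \<Rightarrow> ('b \<Rightarrow> real) \<Rightarrow>
    'a::metric_space \<times> 'b set \<Rightarrow> 'a \<times> 'b set \<Rightarrow> bool" where
  "preceq_Hz H K z w1 w2 \<longleftrightarrow>
     w1 = w2 \<or> (preceq_H H K w1 w2 \<and> inf_over z (snd w1) < inf_over z (snd w2))"

definition decreasing_seq :: "('w \<Rightarrow> 'w \<Rightarrow> bool) \<Rightarrow> (nat \<Rightarrow> 'w) \<Rightarrow> bool" where
  "decreasing_seq le w \<longleftrightarrow> (\<forall>n. le (w (Suc n)) (w n))"

definition minimal_in :: "('w \<Rightarrow> 'w \<Rightarrow> bool) \<Rightarrow> 'w set \<Rightarrow> 'w \<Rightarrow> bool" where
  "minimal_in le \<A> w \<longleftrightarrow> w \<in> \<A> \<and> (\<forall>w'\<in>\<A>. le w' w \<longrightarrow> w' = w)"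

definition cl_seq :: "'b::topological_space set \<Rightarrow> 'b set" where
  "cl_seq E = {l. \<exists>s. (\<forall>n::nat. s n \<in> E) \<and> s \<longlonglongrightarrow> l}"

text \<open>The library's \<open>bounded\<close> is a metric notion; this is boundedness with respect to the
  vector topology (absorption by every neighbourhood of 0).\<close>

definition tvs_bounded :: "'b::hausdorff_tvs set \<Rightarrow> bool" where
  "tvs_bounded E \<longleftrightarrow> (\<forall>U. 0 \<in> interior U \<longrightarrow> (\<exists>t>0. E \<subseteq> (\<lambda>y. t *\<^sub>R y) ` U))"

definition quasi_cone_bounded :: "'b::hausdorff_tvs set \<Rightarrow> 'b set \<Rightarrow> bool" where
  "quasi_cone_bounded K E \<longleftrightarrow> (\<exists>B. tvs_bounded B \<and> E \<subseteq> B + K)"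

definition cone_bounded :: "'b::hausdorff_tvs set \<Rightarrow> 'b set \<Rightarrow> bool" where
  "cone_bounded K E \<longleftrightarrow> (\<forall>U. 0 \<in> interior U \<longrightarrow> (\<exists>t>0. E \<subseteq> (\<lambda>y. t *\<^sub>R y) ` U + K))"

definition dual_cone_bounded :: "'b::hausdorff_tvs set \<Rightarrow> 'b set \<Rightarrow> bool" where
  "dual_cone_bounded K E \<longleftrightarrow> (\<forall>f\<in>dual_cone K. bdd_below (f ` E))"

end

theory Submission
  imports Defs
begin

text \<open>All cases but (ii) follow from a Dancs--Hegedus--Medvegyev type principle: it suffices that no
  decreasing sequence has all consecutive distances at least some \<open>\<epsilon> > 0\<close>. Along such a sequence,
  starting from \<open>a \<in> A\<^sub>0\<close> one finds \<open>a\<^sub>n \<in> A\<^sub>n\<close> with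
  \<open>a - a\<^sub>n \<in> \<epsilon> (h\<^sub>0 + \<dots> + h\<^sub>n\<^sub>-\<^sub>1) + K\<close>, \<open>h\<^sub>i \<in> H\<close>. Dividing by \<open>\<epsilon>n\<close> brings
  0 into the (sequential) closure of the convex set \<open>H + K\<close> in case (i); applying a functional drives
  it to \<open>-\<infinity>\<close> in case (iii); and in case (iv) the sum eventually absorbs the translated bounded set.
  In case (ii), \<open>\<phi> (x, A) = inf z(A)\<close> decreases by at least a multiple of the distance, and a
  decreasing sequence that nearly minimizes \<open>\<phi>\<close> produces the minimal element.\<close>

section \<open>Scaling and bounded sets in topological vector spaces\<close>

lemma tendsto_scaleR_tvs:
  fixes g :: "'c \<Rightarrow> 'b::hausdorff_tvs"
  assumes "(f \<longlongrightarrow> c) F" "(g \<longlongrightarrow> y) F"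
  shows "((\<lambda>x. f x *\<^sub>R g x) \<longlongrightarrow> c *\<^sub>R y) F"
  using filterlim_compose[OF tendsto_scaleR_Pair filterlim_Pair[OF assms]] by simp

text \<open>This is joint continuity of scaling at \<open>(0, 0)\<close>, uniform over all small
  scalars; it takes the place of a base of balanced neighbourhoods.\<close>

lemma tvs_nhds_zero_scaleR:
  fixes W :: "'b::hausdorff_tvs set"
  assumes "open W" "0 \<in> W"
  obtains \<delta> V where "\<delta> > 0" "open V" "0 \<in> V" "\<And>c y. \<bar>c\<bar> < \<delta> \<Longrightarrow> y \<in> V \<Longrightarrow> c *\<^sub>R y \<in> W"
proof -
  have "eventually (\<lambda>p. fst p *\<^sub>R snd p \<in> W) (nhds (0::real) \<times>\<^sub>F nhds (0::'b))"
    using topological_tendstoD[OF tendsto_scaleR_Pair[of 0 "0::'b"] assms(1)] assms(2) by simp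
  then obtain P Q where P: "eventually P (nhds (0::real))" and Q: "eventually Q (nhds (0::'b))"
    and PQ: "\<And>x y. P x \<Longrightarrow> Q y \<Longrightarrow> x *\<^sub>R y \<in> W"
    unfolding eventually_prod_filter by auto
  obtain \<delta> where "\<delta> > 0" "\<And>c. dist c 0 < \<delta> \<Longrightarrow> P c"
    using P unfolding eventually_nhds_metric by blast
  moreover obtain V where "open V" "0 \<in> V" "\<And>y. y \<in> V \<Longrightarrow> Q y"
    using Q unfolding eventually_nhds by blast
  ultimately show ?thesis using PQ that[of \<delta> V] by (simp add: dist_real_def)
qed

lemma tvs_nhds_zero_add:
  fixes W :: "'b::hausdorff_tvs set"
  assumes "open W" "0 \<in> W"
  obtains V where "open V" "0 \<in> V" "\<And>u v. u \<in> V \<Longrightarrow> v \<in> V \<Longrightarrow> u + v \<in> W"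
proof -
  have "eventually (\<lambda>p. fst p + snd p \<in> W) (nhds (0::'b) \<times>\<^sub>F nhds (0::'b))"
    using topological_tendstoD[OF tendsto_add_Pair[of 0 "0::'b"] assms(1)] assms(2) by simp
  then obtain P Q where P: "eventually P (nhds (0::'b))" and Q: "eventually Q (nhds (0::'b))"
    and PQ: "\<And>x y. P x \<Longrightarrow> Q y \<Longrightarrow> x + y \<in> W"
    unfolding eventually_prod_filter by auto
  obtain U where "open U" "0 \<in> U" "\<And>y. y \<in> U \<Longrightarrow> P y"
    using P unfolding eventually_nhds by blast
  moreover obtain V where "open V" "0 \<in> V" "\<And>y. y \<in> V \<Longrightarrow> Q y"
    using Q unfolding eventually_nhds by blast
  ultimately show ?thesis using PQ that[of "U \<inter> V"] by auto
qed

text \<open>A single absorption of \<open>B\<close> by a multiple of \<open>V\<close> handles all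
  small scalars at once: if \<open>b = t *\<^sub>R y\<close>, then \<open>c *\<^sub>R b\<close> is
  \<open>y\<close> scaled by \<open>c * t\<close>, which is below the threshold for
  \<open>V\<close>.\<close>

lemma tvs_bounded_scaleR:
  assumes "tvs_bounded B" "open W" "0 \<in> W"
  obtains \<delta> where "\<delta> > 0" "\<And>c b. \<bar>c\<bar> < \<delta> \<Longrightarrow> b \<in> B \<Longrightarrow> c *\<^sub>R b \<in> W"
proof -
  obtain \<delta> V where V: "\<delta> > 0" "open V" "0 \<in> V" "\<And>c y. \<bar>c\<bar> < \<delta> \<Longrightarrow> y \<in> V \<Longrightarrow> c *\<^sub>R y \<in> W"
    using tvs_nhds_zero_scaleR[OF assms(2,3)] by metis
  obtain t where t: "t > 0" "B \<subseteq> (\<lambda>y. t *\<^sub>R y) ` V"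
    using assms(1) V(2,3) unfolding tvs_bounded_def by (metis interior_open)
  have "c *\<^sub>R b \<in> W" if c: "\<bar>c\<bar> < \<delta> / t" and b: "b \<in> B" for c b
  proof -
    obtain y where y: "y \<in> V" "b = t *\<^sub>R y" using t b by blast
    have "\<bar>c * t\<bar> < \<delta>" using c t by (simp add: abs_mult field_simps)
    from V(4)[OF this y(1)] show ?thesis using y by simp
  qed
  then show ?thesis using that[of "\<delta> / t"] V(1) t(1) by simp
qed

lemma tvs_bounded_tendsto_zero:
  fixes b :: "'c \<Rightarrow> 'b::hausdorff_tvs"
  assumes "tvs_bounded B" "\<And>n. b n \<in> B" "(f \<longlongrightarrow> 0) F"
  shows "((\<lambda>n. f n *\<^sub>R b n) \<longlongrightarrow> 0) F"
proof (rule topological_tendstoI)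
  fix W :: "'b set" assume "open W" "0 \<in> W"
  then obtain \<delta> where \<delta>: "\<delta> > 0" "\<And>c b. \<bar>c\<bar> < \<delta> \<Longrightarrow> b \<in> B \<Longrightarrow> c *\<^sub>R b \<in> W"
    using tvs_bounded_scaleR[OF assms(1)] by metis
  have "eventually (\<lambda>n. \<bar>f n\<bar> < \<delta>) F"
    using tendstoD[OF assms(3) \<delta>(1)] by (simp add: dist_real_def)
  then show "eventually (\<lambda>n. f n *\<^sub>R b n \<in> W) F"
    by eventually_elim (use \<delta> assms(2) in auto)
qed

text \<open>The index shift keeps \<open>real (Suc n)\<close> away from 0. For \<open>e = 0\<close>
  division by zero gives the constant sequence 0.\<close>

lemma tendsto_inverse_mult_Suc: "(\<lambda>n. 1 / (e * real (Suc n))) \<longlonglongrightarrow> 0"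
proof -
  have "(\<lambda>n. 1 / (e * real (Suc n))) = (\<lambda>n. (1 / e) * inverse (real (Suc n)))"
    by (auto simp: field_simps)
  then show ?thesis using tendsto_mult_right[OF LIMSEQ_inverse_real_of_nat, of "1/e"] by simp
qed

lemma convex_cone_sum:
  assumes "convex_cone C" "\<And>i. i \<in> I \<Longrightarrow> f i \<in> C"
  shows "sum f I \<in> C"
  using assms(2) by (induction I rule: infinite_finite_induct)
    (use assms(1) in \<open>auto simp: convex_cone_iff\<close>)

section \<open>Preorders without drift\<close>

lemma chain_preceq:
  assumes "\<And>x. R x x" "\<And>x y z. R x y \<Longrightarrow> R y z \<Longrightarrow> R x z" "\<And>n::nat. R (w (Suc n)) (w n)" "m \<le> n"
  shows "R (w n) (w m)"
  using \<open>m \<le> n\<close> by (induction rule: dec_induct) (use assms in blast)+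

text \<open>\<open>R\<close> need not be antisymmetric, so only the projection \<open>p\<close> is
  pinned down. Absence of drift puts below each point one whose lower section has small radius under
  \<open>p\<close>. Iterating with radii tending to 0 gives a Cauchy sequence; a lower bound of it
  and everything below that bound lie in all these sections, so their projections agree.\<close>

lemma minimal_projection_of_no_drift:
  fixes p :: "'w \<Rightarrow> 'a::metric_space"
  assumes refl: "\<And>x. R x x" and trans: "\<And>x y z. R x y \<Longrightarrow> R y z \<Longrightarrow> R x z"
    and no_drift: "\<And>e w. e > 0 \<Longrightarrow> (\<And>n::nat. w n \<in> S) \<Longrightarrow> (\<And>n. R (w (Suc n)) (w n)) \<Longrightarrow>
        (\<And>n. e \<le> dist (p (w (Suc n))) (p (w n))) \<Longrightarrow> False"
    and complete: "\<And>w. (\<And>n::nat. w n \<in> S) \<Longrightarrow> (\<And>n. R (w (Suc n)) (w n)) \<Longrightarrow>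
        Cauchy (\<lambda>n. p (w n)) \<Longrightarrow> \<exists>v\<in>S. \<forall>n. R v (w n)"
    and w: "w \<in> S"
  shows "\<exists>v\<in>S. R v w \<and> (\<forall>u\<in>S. R u v \<longrightarrow> p u = p v)"
proof -
  have small: "\<exists>v\<in>S. R v w \<and> (\<forall>u\<in>S. R u v \<longrightarrow> dist (p u) (p v) < e)"
    if "e > 0" "w \<in> S" for e w
  proof (rule ccontr)
    assume contr: "\<not> ?thesis"
    \<comment> \<open>If the claim fails, each point below \<open>w\<close> has a predecessor at
      distance at least \<open>e\<close>, which is again below \<open>w\<close>. Repeated choice of
      such predecessors is a drift.\<close>
    have "\<exists>f. \<forall>n::nat. (f n \<in> S \<and> R (f n) w) \<and>
        (R (f (Suc n)) (f n) \<and> e \<le> dist (p (f (Suc n))) (p (f n)))"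
      by (rule dependent_nat_choice) (use contr refl trans \<open>w \<in> S\<close> in \<open>blast, meson not_le\<close>)
    then show False using no_drift[OF \<open>e > 0\<close>] by metis
  qed
  have "\<exists>f. \<forall>n::nat. (f n \<in> S \<and> R (f n) w \<and>
        (\<forall>u\<in>S. R u (f n) \<longrightarrow> dist (p u) (p (f n)) < inverse (real (Suc n)))) \<and> R (f (Suc n)) (f n)"
  proof (rule dependent_nat_choice)
    show "\<exists>v. v \<in> S \<and> R v w \<and> (\<forall>u\<in>S. R u v \<longrightarrow> dist (p u) (p v) < inverse (real (Suc 0)))"
      using small[of 1 w] w by auto
    show "\<exists>y. (y \<in> S \<and> R y w \<and>
          (\<forall>u\<in>S. R u y \<longrightarrow> dist (p u) (p y) < inverse (real (Suc (Suc n))))) \<and> R y x"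
      if "x \<in> S \<and> R x w \<and> (\<forall>u\<in>S. R u x \<longrightarrow> dist (p u) (p x) < inverse (real (Suc n)))" for x n
      using small[of "inverse (real (Suc (Suc n)))" x] that trans[of _ x w] by fastforce
  qed
  then obtain f where f: "\<And>n::nat. f n \<in> S" "\<And>n. R (f n) w" "\<And>n. R (f (Suc n)) (f n)"
    and fd: "\<And>n u. u \<in> S \<Longrightarrow> R u (f n) \<Longrightarrow> dist (p u) (p (f n)) < inverse (real (Suc n))"
    by blast
  have mono: "R (f n) (f m)" if "m \<le> n" for m n
    using chain_preceq[of R f m n] refl trans f(3) that by blast
  have tail: "\<exists>N. inverse (real (Suc N)) < e / 2" if "e > 0" for e
    using reals_Archimedean[of "e/2"] that by auto
  \<comment> \<open>Both projections lie within \<open>e / 2\<close> of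
    \<open>p (f N)\<close>.\<close>
  have close: "dist (p u) (p v) < e" if "inverse (real (Suc N)) < e / 2"
    "u \<in> S" "v \<in> S" "R u (f N)" "R v (f N)" for e N u v
    using fd[OF that(2,4)] fd[OF that(3,5)] that(1) dist_triangle2[of "p u" "p v" "p (f N)"] by simp
  have "Cauchy (\<lambda>n. p (f n))"
    by (rule metric_CauchyI) (metis tail close f(1) mono)
  then obtain v where v: "v \<in> S" "\<And>n. R v (f n)" using complete f by metis
  have "p u = p v" if u: "u \<in> S" "R u v" for u
  proof (rule ccontr)
    assume "p u \<noteq> p v"
    then obtain N where "inverse (real (Suc N)) < dist (p u) (p v) / 2" using tail by force
    then show False using close u v trans by (meson less_irrefl)
  qed
  then show ?thesis using v f(2)[of 0] trans by blast
qed

section \<open>Algebra of the perturbed order\<close>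

locale cone_perturbation =
  fixes K H :: "'b::real_vector set"
  assumes cone: "convex_cone K" and nonempty: "H \<noteq> {}" and sub: "H \<subseteq> K" and conv: "convex (H + K)"
begin

lemma K_closed: "0 \<in> K" "x \<in> K \<Longrightarrow> y \<in> K \<Longrightarrow> x + y \<in> K" "c \<ge> 0 \<Longrightarrow> x \<in> K \<Longrightarrow> c *\<^sub>R x \<in> K"
  using cone by (auto simp: convex_cone_iff)

lemma perturbed_closed: "g \<in> H + K \<Longrightarrow> k \<in> K \<Longrightarrow> g + k \<in> H + K"
  by (metis (no_types, lifting) K_closed(2) add.assoc set_plus_elim set_plus_intro)

lemma preceq_iff:
  "preceq_H H K w1 w2 \<longleftrightarrow> (\<forall>b\<in>snd w2. \<exists>a\<in>snd w1. \<exists>h\<in>H. \<exists>k\<in>K.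
      b = a + dist (fst w1) (fst w2) *\<^sub>R h + k)"
  unfolding preceq_H_def set_plus_def subset_iff by (simp add: Bex_def) blast

text \<open>The surplus \<open>(s - t) *\<^sub>R h\<close> lies in \<open>K\<close> and joins the
  cone part. This absorbs the slack of the triangle inequality and lowers distances to a common
  bound.\<close>

lemma shrink_coefficient:
  assumes "h \<in> H" "k \<in> K" "t \<le> s"
  shows "\<exists>k'\<in>K. s *\<^sub>R h + k = t *\<^sub>R h + k'"
proof
  show "(s - t) *\<^sub>R h + k \<in> K" using assms sub K_closed by auto
qed (simp add: algebra_simps)

text \<open>Convexity of \<open>H + K\<close> is applied to the average with weights
  \<open>s / (s + t)\<close> and \<open>t / (s + t)\<close>, then multiplied back. Convexity is
  assumed of \<open>H + K\<close> and not of \<open>H\<close>, hence the remainder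
  \<open>k\<close>.\<close>

lemma scaled_sum:
  assumes "h \<in> H" "h' \<in> H" "s \<ge> 0" "t \<ge> 0"
  shows "\<exists>g\<in>H. \<exists>k\<in>K. s *\<^sub>R h + t *\<^sub>R h' = (s + t) *\<^sub>R g + k"
proof (cases "s + t = 0")
  \<comment> \<open>The weights are undefined here, but both coefficients vanish: any element of
    \<open>H\<close> works, with remainder 0.\<close>
  case True
  then have "s = 0" "t = 0" using assms by auto
  then show ?thesis using assms(1) K_closed(1) by force
next
  case False
  then have st: "s + t > 0" using assms by simp
  have mem: "h \<in> H + K" "h' \<in> H + K"
    using set_plus_intro[OF _ K_closed(1)] assms by force+
  have "(s / (s+t)) *\<^sub>R h + (t / (s+t)) *\<^sub>R h' \<in> H + K"
    by (rule convexD[OF conv mem]) (use st assms in \<open>simp_all add: add_divide_distrib[symmetric]\<close>)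
  then obtain g k where g: "g \<in> H" "k \<in> K"
    "(s / (s+t)) *\<^sub>R h + (t / (s+t)) *\<^sub>R h' = g + k" by (metis set_plus_elim)
  have "s *\<^sub>R h + t *\<^sub>R h' = (s + t) *\<^sub>R ((s / (s+t)) *\<^sub>R h + (t / (s+t)) *\<^sub>R h')"
    using st by (simp add: scaleR_add_right)
  also have "\<dots> = (s + t) *\<^sub>R g + (s + t) *\<^sub>R k" unfolding g(3) by (simp add: scaleR_add_right)
  finally show ?thesis using g st K_closed(3) by (meson less_imp_le)
qed

lemma preceq_refl: "preceq_H H K w w"
  using nonempty K_closed(1) unfolding preceq_iff by force

text \<open>\<open>scaled_sum\<close> merges the two perturbations into one whose coefficient is the
  sum of the distances; \<open>shrink_coefficient\<close> reduces it to the distance of the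
  endpoints.\<close>

lemma preceq_trans:
  assumes "preceq_H H K w1 w2" "preceq_H H K w2 w3"
  shows "preceq_H H K w1 w3"
  unfolding preceq_iff
proof
  fix c assume "c \<in> snd w3"
  let ?s = "dist (fst w2) (fst w3)" and ?t = "dist (fst w1) (fst w2)"
  obtain b h k where 1: "b \<in> snd w2" "h \<in> H" "k \<in> K" "c = b + ?s *\<^sub>R h + k"
    using assms(2) \<open>c \<in> snd w3\<close> unfolding preceq_iff by blast
  obtain a h' k' where 2: "a \<in> snd w1" "h' \<in> H" "k' \<in> K" "b = a + ?t *\<^sub>R h' + k'"
    using assms(1) 1(1) unfolding preceq_iff by blast
  obtain g l where 3: "g \<in> H" "l \<in> K" "?s *\<^sub>R h + ?t *\<^sub>R h' = (?s + ?t) *\<^sub>R g + l"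
    using scaled_sum[OF 1(2) 2(2)] by (metis zero_le_dist)
  have "dist (fst w1) (fst w3) \<le> ?s + ?t" using dist_triangle[of "fst w1" "fst w3" "fst w2"] by simp
  then obtain l' where 4: "l' \<in> K" "(?s + ?t) *\<^sub>R g + l = dist (fst w1) (fst w3) *\<^sub>R g + l'"
    using shrink_coefficient[OF 3(1,2)] by blast
  have "c = a + (?s *\<^sub>R h + ?t *\<^sub>R h') + (k + k')" using 1(4) 2(4) by (simp add: algebra_simps)
  also have "\<dots> = a + dist (fst w1) (fst w3) *\<^sub>R g + (l' + k + k')"
    unfolding 3(3) 4(2) by (simp add: algebra_simps)
  finally show "\<exists>a\<in>snd w1. \<exists>h\<in>H. \<exists>k\<in>K. c = a + dist (fst w1) (fst w3) *\<^sub>R h + k"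
    using 2(1) 3(1) 4(1) 1(3) 2(3) K_closed(2) by blast
qed

text \<open>Points are chosen successively, each step lowering its distance to \<open>e\<close>. The
  differences telescope and the cone parts add up inside \<open>K\<close>.\<close>

lemma drift_chain:
  fixes w :: "nat \<Rightarrow> 'a::metric_space \<times> 'b set"
  assumes dec: "\<And>n. preceq_H H K (w (Suc n)) (w n)"
    and far: "\<And>n. e \<le> dist (fst (w (Suc n))) (fst (w n))"
    and start: "y \<in> snd (w 0)"
  obtains a h where "\<And>n. a n \<in> snd (w n)" "\<And>n. h n \<in> H"
    "\<And>n. y - a n - e *\<^sub>R (\<Sum>i<n. h i) \<in> K"
proof -
  have step: "\<exists>a. a \<in> snd (w (Suc n)) \<and> (\<exists>h\<in>H. b - a - e *\<^sub>R h \<in> K)" if "b \<in> snd (w n)" for b n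
  proof -
    obtain a h k where a: "a \<in> snd (w (Suc n))" "h \<in> H" "k \<in> K"
      "b = a + dist (fst (w (Suc n))) (fst (w n)) *\<^sub>R h + k"
      using dec[of n] \<open>b \<in> _\<close> unfolding preceq_iff by blast
    obtain k' where "k' \<in> K" "dist (fst (w (Suc n))) (fst (w n)) *\<^sub>R h + k = e *\<^sub>R h + k'"
      using shrink_coefficient[OF a(2,3) far] by blast
    then have "b - a - e *\<^sub>R h \<in> K" using a(4) by (simp add: algebra_simps)
    then show ?thesis using a by blast
  qed
  \<comment> \<open>The conjunct for \<open>n = 0\<close> forces the choice to start at
    \<open>y\<close>.\<close>
  have "\<exists>a. \<forall>n. (a n \<in> snd (w n) \<and> (n = 0 \<longrightarrow> a n = y)) \<and> (\<exists>h\<in>H. a n - a (Suc n) - e *\<^sub>R h \<in> K)"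
    by (rule dependent_nat_choice) (use start step in \<open>simp_all\<close>)
  then obtain a where a: "\<And>n. a n \<in> snd (w n)" "a 0 = y"
    "\<And>n. \<exists>h\<in>H. a n - a (Suc n) - e *\<^sub>R h \<in> K" by blast
  then obtain h where h: "\<And>n. h n \<in> H" "\<And>n. a n - a (Suc n) - e *\<^sub>R h n \<in> K" by metis
  have "y - a n - e *\<^sub>R (\<Sum>i<n. h i) \<in> K" for n
  proof (induction n)
    case (Suc n)
    from K_closed(2)[OF this h(2)[of n]] show ?case by (simp add: algebra_simps)
  qed (simp add: a K_closed)
  then show ?thesis using that a h by blast
qed

text \<open>The mean of the \<open>h i\<close> lies in the convex set \<open>H + K\<close>, and the
  rescaled remainder in \<open>K\<close>. If the points \<open>b\<close> stay bounded, these vectors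
  tend to 0 as \<open>n\<close> grows.\<close>

lemma drift_mean:
  assumes "\<And>i. h i \<in> H" "n > (0::nat)" "e > 0" "y - b - e *\<^sub>R (\<Sum>i<n. h i) \<in> K"
  shows "(1 / (e * real n)) *\<^sub>R (y - b) \<in> H + K"
proof -
  let ?c = "1 / (e * real n)"
  have "h i \<in> H + K" for i using set_plus_intro[OF assms(1) K_closed(1)] by simp
  then have "(\<Sum>i<n. (1 / real n) *\<^sub>R h i) \<in> H + K"
    by (intro convex_sum[OF _ conv]) (use assms in auto)
  moreover have "?c *\<^sub>R (y - b - e *\<^sub>R (\<Sum>i<n. h i)) \<in> K" using assms K_closed by simp
  ultimately have "(\<Sum>i<n. (1 / real n) *\<^sub>R h i) + ?c *\<^sub>R (y - b - e *\<^sub>R (\<Sum>i<n. h i)) \<in> H + K"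
    by (rule perturbed_closed)
  moreover have "(\<Sum>i<n. (1 / real n) *\<^sub>R h i) = ?c *\<^sub>R (e *\<^sub>R (\<Sum>i<n. h i))"
    using assms by (simp add: scaleR_sum_right)
  ultimately show ?thesis by (simp add: algebra_simps)
qed

end

section \<open>Exclusion of drift in cases (i), (iii) and (iv)\<close>

lemma no_drift_quasi_cone_bounded:
  fixes K H :: "'b::hausdorff_tvs set"
  assumes "cone_perturbation K H" "0 \<notin> cl_seq (H + K)" "quasi_cone_bounded K E"
    and aE: "\<And>n. a n \<in> E" and h: "\<And>n::nat. h n \<in> H" and "e > 0"
    and chain: "\<And>n. y - a n - e *\<^sub>R (\<Sum>i<n. h i) \<in> K"
  shows False
proof -
  interpret cone_perturbation K H by fact
  obtain B where B: "tvs_bounded B" "E \<subseteq> B + K"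
    using assms(3) unfolding quasi_cone_bounded_def by blast
  \<comment> \<open>Each \<open>a n\<close> is replaced by a point of \<open>B\<close>; their
    difference is absorbed by the cone in the chain inequality.\<close>
  have "\<exists>b\<in>B. a n - b \<in> K" for n
    using aE[of n] B(2) unfolding set_plus_def by force
  then obtain b where b: "\<And>n. b n \<in> B" "\<And>n. a n - b n \<in> K" by metis
  have 1: "y - b n - e *\<^sub>R (\<Sum>i<n. h i) \<in> K" for n
    using K_closed(2)[OF chain[of n] b(2)[of n]] by (simp add: algebra_simps)
  let ?f = "\<lambda>n. 1 / (e * real (Suc n))"
  have f: "?f \<longlonglongrightarrow> 0" by (rule tendsto_inverse_mult_Suc)
  have "(\<lambda>n. ?f n *\<^sub>R y - ?f n *\<^sub>R b (Suc n)) \<longlonglongrightarrow> 0 - 0"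
    using tendsto_scaleR_tvs[OF f tendsto_const[of y]] tvs_bounded_tendsto_zero[OF B(1) _ f] b(1)
    by (intro tendsto_diff) auto
  then have "(\<lambda>n. ?f n *\<^sub>R (y - b (Suc n))) \<longlonglongrightarrow> 0" by (simp add: scaleR_diff_right)
  \<comment> \<open>The shift to \<open>Suc n\<close> ensures a nonempty mean.\<close>
  moreover have "?f n *\<^sub>R (y - b (Suc n)) \<in> H + K" for n
    by (rule drift_mean[OF h _ \<open>e > 0\<close> 1]) simp
  ultimately have "0 \<in> cl_seq (H + K)"
    unfolding cl_seq_def by (intro CollectI exI[of _ "\<lambda>n. ?f n *\<^sub>R (y - b (Suc n))"]) auto
  with assms(2) show False by blast
qed

text \<open>The bounding set depends on the neighbourhood, so there is no single bounded sequence to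
  pass to the limit with. Instead one fixes a neighbourhood \<open>W\<close> of 0 missing
  \<open>H + K\<close> and finds one large index whose mean lies in \<open>W\<close>.\<close>

lemma no_drift_cone_bounded:
  fixes K H :: "'b::hausdorff_tvs set"
  assumes "cone_perturbation K H" "0 \<notin> closure (H + K)" "cone_bounded K E"
    and aE: "\<And>n. a n \<in> E" and h: "\<And>n::nat. h n \<in> H" and "e > 0"
    and chain: "\<And>n. y - a n - e *\<^sub>R (\<Sum>i<n. h i) \<in> K"
  shows False
proof -
  interpret cone_perturbation K H by fact
  define W where "W = - closure (H + K)"
  have W: "open W" "0 \<in> W" "W \<inter> (H + K) = {}"
    using assms(2) closure_subset[of "H + K"] unfolding W_def by auto
  obtain V where V: "open V" "0 \<in> V" "\<And>u v. u \<in> V \<Longrightarrow> v \<in> V \<Longrightarrow> u + v \<in> W"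
    using tvs_nhds_zero_add[OF W(1,2)] by metis
  obtain \<delta> U where U: "\<delta> > 0" "open U" "0 \<in> U" "\<And>c y. \<bar>c\<bar> < \<delta> \<Longrightarrow> y \<in> U \<Longrightarrow> c *\<^sub>R y \<in> V"
    using tvs_nhds_zero_scaleR[OF V(1,2)] by metis
  obtain t where t: "t > 0" "E \<subseteq> (\<lambda>y. t *\<^sub>R y) ` U + K"
    using assms(3) U(2,3) unfolding cone_bounded_def by (metis interior_open)
  let ?f = "\<lambda>n. 1 / (e * real (Suc n))"
  have f: "?f \<longlonglongrightarrow> 0" by (rule tendsto_inverse_mult_Suc)
  have "eventually (\<lambda>n. ?f n *\<^sub>R y \<in> V) sequentially"
    using tendsto_scaleR_tvs[OF f tendsto_const[of y]] V(1,2) by (auto dest: topological_tendstoD)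
  moreover have "eventually (\<lambda>n. \<bar>?f n\<bar> < \<delta> / t) sequentially"
    using tendstoD[OF f, of "\<delta> / t"] U(1) t(1) by (simp add: dist_real_def)
  ultimately have "eventually (\<lambda>n. ?f n *\<^sub>R y \<in> V \<and> \<bar>?f n\<bar> < \<delta> / t) sequentially"
    by (rule eventually_conj)
  then obtain n where n: "?f n *\<^sub>R y \<in> V" "\<bar>?f n\<bar> < \<delta> / t"
    by (metis (lifting) eventually_happens sequentially_bot)
  obtain u k where u: "u \<in> U" "k \<in> K" "a (Suc n) = t *\<^sub>R u + k"
    using aE[of "Suc n"] t(2) unfolding set_plus_def by blast
  have "y - t *\<^sub>R u - e *\<^sub>R (\<Sum>i<Suc n. h i) \<in> K"
    using K_closed(2)[OF chain[of "Suc n"] u(2)] u(3) by (simp add: algebra_simps)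
  from drift_mean[OF h _ \<open>e > 0\<close> this]
  have 1: "?f n *\<^sub>R (y - t *\<^sub>R u) \<in> H + K" by simp
  have "\<bar>- (?f n * t)\<bar> < \<delta>" using n(2) t(1) by (simp add: abs_mult pos_less_divide_eq)
  from V(3)[OF n(1) U(4)[OF this u(1)]]
  have "?f n *\<^sub>R (y - t *\<^sub>R u) \<in> W" by (simp add: scaleR_diff_right)
  with 1 W(3) show False by blast
qed

text \<open>Since \<open>z\<close> is nonnegative on \<open>K\<close>, infinitely many values above
  \<open>c > 0\<close> make the sums of \<open>z (h i)\<close> unbounded, whereas the chain bounds
  \<open>e\<close> times each such sum by \<open>z y - m\<close>.\<close>

lemma no_drift_dual_cone_bounded:
  fixes K H :: "'b::hausdorff_tvs set"
  assumes "H \<subseteq> K" and z: "z \<in> dual_cone K" and lims: "limsup (\<lambda>n. ereal (z (h n))) > 0"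
    and "bdd_below (z ` E)"
    and aE: "\<And>n. a n \<in> E" and h: "\<And>n::nat. h n \<in> H" and "e > 0"
    and chain: "\<And>n. y - a n - e *\<^sub>R (\<Sum>i<n. h i) \<in> K"
  shows False
proof -
  have lin: "linear z" and pos: "\<And>y. y \<in> K \<Longrightarrow> z y \<ge> 0"
    using z unfolding dual_cone_def topological_dual_def by auto
  obtain m where m: "\<And>y. y \<in> E \<Longrightarrow> m \<le> z y"
    using assms(4) unfolding bdd_below_def by auto
  \<comment> \<open>A value strictly below the upper limit is exceeded infinitely often; otherwise
    it would bound the upper limit from above.\<close>
  obtain c where c: "0 < ereal c" "ereal c < limsup (\<lambda>n. ereal (z (h n)))"
    using ereal_dense2[OF lims] by blast
  then have "\<exists>\<^sub>F n in sequentially. c < z (h n)"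
    using Limsup_bounded[of "\<lambda>n. ereal (z (h n))" "ereal c" sequentially]
    by (auto simp: frequently_def not_less)
  then have inf: "infinite {n. c < z (h n)}"
    by (simp add: frequently_cofinite cofinite_eq_sequentially[symmetric])
  have "e * (real N * c) \<le> z y - m" for N
  proof -
    obtain J where J: "J \<subseteq> {n. c < z (h n)}" "finite J" "card J = N"
      using inf infinite_arbitrarily_large by blast
    obtain n where n: "J \<subseteq> {..<n}" using J(2) finite_nat_iff_bounded by blast
    have "real N * c \<le> (\<Sum>i\<in>J. z (h i))"
      using sum_bounded_below[of J c "\<lambda>i. z (h i)"] J by force
    also have "\<dots> \<le> (\<Sum>i<n. z (h i))"
      by (rule sum_mono2) (use n pos h assms(1) in auto)
    finally have "e * (real N * c) \<le> e * (\<Sum>i<n. z (h i))" using \<open>e > 0\<close> by simp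
    also have "\<dots> \<le> z y - z (a n)"
      using pos[OF chain[of n]] by (simp add: linear_diff[OF lin] linear_cmul[OF lin] linear_sum[OF lin])
    also have "\<dots> \<le> z y - m" using m[OF aE] by simp
    finally show ?thesis .
  qed
  moreover obtain N where "z y - m < real N * (e * c)"
    using ex_less_of_nat_mult[of "e * c"] c(1) \<open>e > 0\<close> by auto
  ultimately show False by (metis mult.left_commute not_le)
qed

text \<open>Without local convexity, averages of elements near a limit \<open>l\<close> of \<open>h\<close> need not be near \<open>l\<close>.
  Instead the vector \<open>b - y\<close> is split evenly among \<open>m\<close> summands \<open>h\<^sub>i\<close> close to \<open>l\<close>,
  each of which then stays in \<open>C\<close>.\<close>

lemma no_drift_seq_compact:
  fixes K H :: "'b::hausdorff_tvs set"
  assumes "H \<subseteq> K" "seq_compact H" "tvs_bounded B" "convex_cone C" "K \<subseteq> C" "H \<subseteq> interior C"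
    and not_absorbed: "\<And>n. \<not> B \<subseteq> A n + C"
    and aA: "\<And>n. a n \<in> A n" and h: "\<And>n::nat. h n \<in> H" and "e > 0"
    and chain: "\<And>n. y - a n - e *\<^sub>R (\<Sum>i<n. h i) \<in> K"
  shows False
proof -
  have C: "0 \<in> C" "\<And>x y. x \<in> C \<Longrightarrow> y \<in> C \<Longrightarrow> x + y \<in> C" "\<And>c x. c \<ge> 0 \<Longrightarrow> x \<in> C \<Longrightarrow> c *\<^sub>R x \<in> C"
    using assms(4) by (auto simp: convex_cone_iff)
  obtain l r where l: "l \<in> H" "strict_mono r" "(h \<circ> r) \<longlonglongrightarrow> l"
    using assms(2) h unfolding seq_compact_def by metis
  \<comment> \<open>These are the increments that keep \<open>l\<close> inside
    \<open>interior C\<close>. Below, \<open>V\<close> leaves room for the two increments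
    \<open>h i - l\<close> and \<open>?q\<close>.\<close>
  let ?W = "(\<lambda>x. l + x) -` interior C"
  have W: "open ?W" "0 \<in> ?W"
    using l(1) assms(6) by (auto intro!: open_vimage continuous_intros)
  obtain V where V: "open V" "0 \<in> V" "\<And>u v. u \<in> V \<Longrightarrow> v \<in> V \<Longrightarrow> u + v \<in> ?W"
    using tvs_nhds_zero_add[OF W] by metis
  \<comment> \<open>The increment \<open>?q\<close> is itself a sum, of a rescaled \<open>b\<close>
    and a rescaled \<open>-y\<close>, so \<open>V\<close> is halved again.\<close>
  obtain V' where V': "open V'" "0 \<in> V'" "\<And>u v. u \<in> V' \<Longrightarrow> v \<in> V' \<Longrightarrow> u + v \<in> V"
    using tvs_nhds_zero_add[OF V(1,2)] by metis
  obtain \<delta> where \<delta>: "\<delta> > 0" "\<And>c b. \<bar>c\<bar> < \<delta> \<Longrightarrow> b \<in> B \<Longrightarrow> c *\<^sub>R b \<in> V'"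
    using tvs_bounded_scaleR[OF assms(3) V'(1,2)] by metis
  let ?f = "\<lambda>n. 1 / (e * real (Suc n))"
  have f: "?f \<longlonglongrightarrow> 0" by (rule tendsto_inverse_mult_Suc)
  have "eventually (\<lambda>n. ?f n *\<^sub>R (-y) \<in> V') sequentially"
    using tendsto_scaleR_tvs[OF f tendsto_const[of "-y"]] V'(1,2) by (auto dest: topological_tendstoD)
  moreover have "eventually (\<lambda>n. \<bar>?f n\<bar> < \<delta>) sequentially"
    using tendstoD[OF f \<delta>(1)] by (simp add: dist_real_def)
  ultimately have "eventually (\<lambda>n. ?f n *\<^sub>R (-y) \<in> V' \<and> \<bar>?f n\<bar> < \<delta>) sequentially"
    by (rule eventually_conj)
  then obtain m' where m': "?f m' *\<^sub>R (-y) \<in> V'" "\<bar>?f m'\<bar> < \<delta>"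
    by (metis (lifting) eventually_happens sequentially_bot)
  define m where "m = Suc m'"
  have m: "m > 0" "(1 / (e * real m)) *\<^sub>R (-y) \<in> V'" "\<bar>1 / (e * real m)\<bar> < \<delta>"
    using m' unfolding m_def by auto
  have "(\<lambda>n. (h \<circ> r) n - l) \<longlonglongrightarrow> 0" using tendsto_diff[OF l(3) tendsto_const[of l]] by simp
  then have "eventually (\<lambda>n. (h \<circ> r) n - l \<in> V) sequentially"
    using V(1,2) by (rule topological_tendstoD)
  then obtain n0 where n0: "\<And>n. n \<ge> n0 \<Longrightarrow> h (r n) - l \<in> V"
    unfolding eventually_sequentially by auto
  \<comment> \<open>Injectivity of \<open>r\<close> makes these exactly \<open>m\<close> indices,
    all with \<open>h i\<close> close to \<open>l\<close>.\<close>
  define J where "J = r ` {n0..<n0+m}"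
  have J: "finite J" "card J = m" "\<And>i. i \<in> J \<Longrightarrow> h i - l \<in> V"
    unfolding J_def using n0 card_image[of r "{n0..<n0+m}"] strict_mono_imp_inj_on[OF l(2)]
    by (auto simp: inj_on_subset)
  obtain n where n: "J \<subseteq> {..<n}" using J(1) finite_nat_iff_bounded by blast
  have "B \<subseteq> A n + C"
  proof
    fix b assume b: "b \<in> B"
    let ?q = "(1 / (e * real m)) *\<^sub>R (b - y)"
    have q: "?q \<in> V" using V'(3)[OF \<delta>(2)[OF m(3) b] m(2)] by (simp add: algebra_simps)
    have "h i + ?q \<in> C" if "i \<in> J" for i
      using V(3)[OF J(3)[OF that] q] interior_subset by (auto simp: algebra_simps)
    then have "(\<Sum>i\<in>J. h i + ?q) \<in> C" by (rule convex_cone_sum[OF assms(4)])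
    moreover have "(\<Sum>i\<in>{..<n} - J. h i) \<in> C"
      using h assms(1,5) by (intro convex_cone_sum[OF assms(4)]) auto
    ultimately have "e *\<^sub>R ((\<Sum>i\<in>J. h i + ?q) + (\<Sum>i\<in>{..<n} - J. h i)) \<in> C"
      using C \<open>e > 0\<close> by simp
    \<comment> \<open>The \<open>m\<close> copies of \<open>?q\<close> add up to
      \<open>b - y\<close> divided by \<open>e\<close>, independently of \<open>m\<close>.\<close>
    moreover have "(\<Sum>i\<in>J. h i + ?q) = (\<Sum>i\<in>J. h i) + (1 / e) *\<^sub>R (b - y)"
      using J(2) m(1) by (simp add: sum.distrib sum_constant_scaleR)
    moreover have "(\<Sum>i<n. h i) = (\<Sum>i\<in>J. h i) + (\<Sum>i\<in>{..<n} - J. h i)"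
      using sum.subset_diff[OF n, of h] by (simp add: add.commute)
    ultimately have "e *\<^sub>R (\<Sum>i<n. h i) + (b - y) \<in> C"
      using \<open>e > 0\<close> by (simp add: scaleR_add_right add_ac)
    from C(2)[OF this] chain[of n] assms(5)
    have "e *\<^sub>R (\<Sum>i<n. h i) + (b - y) + (y - a n - e *\<^sub>R (\<Sum>i<n. h i)) \<in> C" by blast
    then have "b - a n \<in> C" by (simp add: algebra_simps)
    from set_plus_intro[OF aA[of n] this] show "b \<in> A n + C" by simp
  qed
  with not_absorbed show False by blast
qed

section \<open>The minimal element in case (ii)\<close>

lemma inf_over_eq:
  assumes "A \<noteq> {}" "\<And>y. y \<in> A \<Longrightarrow> m \<le> f y"
  shows "inf_over f A = ereal (INF y\<in>A. f y)"
proof -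
  have "bdd_below (f ` A)" using assms(2) by (auto simp: bdd_below_def)
  from ereal_Inf'[OF this] assms(1) show ?thesis unfolding inf_over_def by (simp add: image_image)
qed

text \<open>Each \<open>f n\<close> minimizes \<phi> on its own lower section up to
  \<open>inverse (real (Suc n))\<close>. As the decrease of \<phi> dominates \<open>c\<close> times
  the distance, the projections are Cauchy. Completeness supplies a bound for
  \<open>preceq_H\<close> only, so strict decrease of \<phi> has to be settled by a case
  split.\<close>

lemma minimal_of_functional:
  fixes K H :: "'b::hausdorff_tvs set" and S :: "('a::metric_space \<times> 'b set) set"
  assumes "cone_perturbation K H" and ne: "\<And>w. w \<in> S \<Longrightarrow> snd w \<noteq> {}"
    and complete: "\<And>w :: nat \<Rightarrow> 'a \<times> 'b set.
        (\<And>n. w n \<in> S) \<Longrightarrow> (\<And>n. preceq_H H K (w (Suc n)) (w n)) \<Longrightarrow> Cauchy (\<lambda>n. fst (w n)) \<Longrightarrow>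
        \<exists>v\<in>S. \<forall>n. preceq_H H K v (w n)"
    and z: "z \<in> dual_cone K" "inf_over z H > 0"
    and below: "\<And>w y. w \<in> S \<Longrightarrow> y \<in> snd w \<Longrightarrow> m \<le> z y"
    and w: "w \<in> S"
  shows "\<exists>v\<in>S. preceq_H H K v w \<and> (\<forall>v'\<in>S. preceq_H H K v' v \<longrightarrow> fst v' = fst v) \<and>
      minimal_in (preceq_Hz H K z) S v \<and> preceq_Hz H K z v w"
proof -
  interpret cone_perturbation K H by fact
  have lin: "linear z" and pos: "\<And>y. y \<in> K \<Longrightarrow> z y \<ge> 0"
    using z(1) unfolding dual_cone_def topological_dual_def by auto
  obtain c where c: "0 < ereal c" "ereal c < inf_over z H"
    using ereal_dense2[OF z(2)] by blast
  have c_le: "c \<le> z h" if "h \<in> H" for h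
    using less_INF_D[OF c(2)[unfolded inf_over_def] that] by simp
  define \<phi> where "\<phi> v = (INF y\<in>snd v. z y)" for v :: "'a \<times> 'b set"
  have inf_\<phi>: "inf_over z (snd v) = ereal (\<phi> v)" if "v \<in> S" for v
    unfolding \<phi>_def by (rule inf_over_eq[OF ne[OF that] below[OF that]])
  have bdd: "bdd_below (z ` snd v)" if "v \<in> S" for v
    using below[OF that] by (auto simp: bdd_below_def)
  have \<phi>_below: "m \<le> \<phi> v" if "v \<in> S" for v
    unfolding \<phi>_def by (rule cINF_greatest[OF ne]) (use below that in auto)
  have decr: "\<phi> u + c * dist (fst u) (fst v) \<le> \<phi> v"
    if uv: "u \<in> S" "v \<in> S" "preceq_H H K u v" for u v
    unfolding \<phi>_def[of v]
  proof (rule cINF_greatest[OF ne[OF uv(2)]])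
    fix b assume "b \<in> snd v"
    then obtain a h k where a: "a \<in> snd u" "h \<in> H" "k \<in> K" "b = a + dist (fst u) (fst v) *\<^sub>R h + k"
      using uv(3) unfolding preceq_iff by blast
    have "z b = z a + dist (fst u) (fst v) * z h + z k"
      using a(4) by (simp add: linear_add[OF lin] linear_cmul[OF lin])
    moreover have "\<phi> u \<le> z a" unfolding \<phi>_def by (rule cINF_lower[OF bdd[OF uv(1)] a(1)])
    moreover have "c * dist (fst u) (fst v) \<le> dist (fst u) (fst v) * z h"
      using c_le[OF a(2)] by (simp add: mult.commute mult_right_mono)
    ultimately show "\<phi> u + c * dist (fst u) (fst v) \<le> z b" using pos[OF a(3)] by simp
  qed
  have decr': "\<phi> u \<le> \<phi> v" if "u \<in> S" "v \<in> S" "preceq_H H K u v" for u v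
    using decr[OF that] c(1) by (smt (verit) ereal_less(2) mult_nonneg_nonneg zero_le_dist)
  let ?R = "preceq_Hz H K z"
  have R_iff: "?R u v \<longleftrightarrow> u = v \<or> (preceq_H H K u v \<and> \<phi> u < \<phi> v)" if "u \<in> S" "v \<in> S" for u v
    using that by (simp add: preceq_Hz_def inf_\<phi>)
  have R_refl: "?R u u" for u by (simp add: preceq_Hz_def)
  have R_trans: "?R x y \<Longrightarrow> ?R y u \<Longrightarrow> ?R x u" for x y u
    unfolding preceq_Hz_def using preceq_trans by (metis less_trans)
  have R_H: "preceq_H H K u v" if "?R u v" for u v
    using that preceq_refl unfolding preceq_Hz_def by metis
  \<comment> \<open>An almost minimizer over the lower section of \<open>w\<close> also works on its
    own lower section, which is smaller by transitivity.\<close>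
  have small: "\<exists>v\<in>S. ?R v w \<and> (\<forall>u\<in>S. ?R u v \<longrightarrow> \<phi> v < \<phi> u + e)" if "e > 0" "w \<in> S" for e w
  proof -
    let ?T = "{u \<in> S. ?R u w}"
    have T: "?T \<noteq> {}" "bdd_below (\<phi> ` ?T)"
      using that R_refl \<phi>_below by (blast, auto intro!: bdd_belowI2)
    obtain v where v: "v \<in> ?T" "\<phi> v < (INF u\<in>?T. \<phi> u) + e"
      using cINF_less_iff[OF T, of "(INF u\<in>?T. \<phi> u) + e"] \<open>e > 0\<close> by auto
    have "\<phi> v < \<phi> u + e" if u: "u \<in> S" "?R u v" for u
    proof -
      have "u \<in> ?T" using u v(1) R_trans by blast
      from cINF_lower[OF T(2) this] show ?thesis using v(2) by simp
    qed
    then show ?thesis using v by blast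
  qed
  have "\<exists>f. \<forall>n::nat. (f n \<in> S \<and> ?R (f n) w \<and>
        (\<forall>u\<in>S. ?R u (f n) \<longrightarrow> \<phi> (f n) < \<phi> u + inverse (real (Suc n)))) \<and> ?R (f (Suc n)) (f n)"
  proof (rule dependent_nat_choice)
    show "\<exists>v. v \<in> S \<and> ?R v w \<and> (\<forall>u\<in>S. ?R u v \<longrightarrow> \<phi> v < \<phi> u + inverse (real (Suc 0)))"
      using small[of 1 w] w by auto
    show "\<exists>y. (y \<in> S \<and> ?R y w \<and>
          (\<forall>u\<in>S. ?R u y \<longrightarrow> \<phi> y < \<phi> u + inverse (real (Suc (Suc n))))) \<and> ?R y x"
      if "x \<in> S \<and> ?R x w \<and> (\<forall>u\<in>S. ?R u x \<longrightarrow> \<phi> x < \<phi> u + inverse (real (Suc n)))" for x n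
      using small[of "inverse (real (Suc (Suc n)))" x] that R_trans[of _ x w]
      by (metis inverse_positive_iff_positive of_nat_0_less_iff zero_less_Suc)
  qed
  then obtain f where f: "\<And>n::nat. f n \<in> S" "\<And>n. ?R (f n) w" "\<And>n. ?R (f (Suc n)) (f n)"
    and near: "\<And>n u. u \<in> S \<Longrightarrow> ?R u (f n) \<Longrightarrow> \<phi> (f n) < \<phi> u + inverse (real (Suc n))"
    by blast
  have mono: "?R (f n) (f k)" if "k \<le> n" for k n
    using chain_preceq[of ?R f k n] R_refl R_trans f(3) that by blast
  have "Cauchy (\<lambda>n. fst (f n))"
    unfolding Cauchy_altdef2
  proof (intro allI impI)
    fix e :: real assume "e > 0"
    then obtain N where N: "inverse (real (Suc N)) < c * e"
      using reals_Archimedean[of "c * e"] c(1) by auto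
    have "dist (fst (f n)) (fst (f N)) < e" if "n \<ge> N" for n
    proof -
      \<comment> \<open>From \<open>f N\<close> to \<open>f n\<close> the functional drops by at
        least the left side, but by less than \<open>inverse (real (Suc N))\<close> by near
        minimality of \<open>f N\<close>.\<close>
      have "c * dist (fst (f n)) (fst (f N)) < c * e"
        using decr[OF f(1) f(1) R_H[OF mono[OF that]]] near[OF f(1) mono[OF that]] N by simp
      then show ?thesis using c(1) by simp
    qed
    then show "\<exists>N. \<forall>n\<ge>N. dist (fst (f n)) (fst (f N)) < e" by blast
  qed
  then obtain v where v: "v \<in> S" "\<And>n. preceq_H H K v (f n)"
    using complete[of f] f(1,3) R_H by blast
  text \<open>If \<open>\<phi> v = \<phi> (f n)\<close>, then \<open>v\<close> need not precede \<open>f n\<close> strictly, but \<open>f\<close> is constant from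
    \<open>n\<close> on and its limit value is minimal.\<close>
  have "\<exists>v\<in>S. ?R v w \<and> minimal_in ?R S v"
  proof (cases "\<exists>n. \<phi> (f n) \<le> \<phi> v")
    case True
    then obtain n where n: "\<phi> (f n) \<le> \<phi> v" by blast
    \<comment> \<open>If \<open>f k\<close> differed from \<open>f n\<close>, then \<phi> would be
      strictly smaller at \<open>f k\<close> than at \<open>f n\<close>, hence smaller than at the
      lower bound \<open>v\<close>.\<close>
    have const: "f k = f n" if "k \<ge> n" for k
      using mono[OF that] decr'[OF v(1) f(1) v(2), of k] n unfolding R_iff[OF f(1) f(1)] by auto
    have "u = f n" if u: "u \<in> S" "?R u (f n)" for u
    proof (rule ccontr)
      assume "u \<noteq> f n"
      then have "\<phi> u < \<phi> (f n)" using u R_iff f(1) by blast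
      then obtain N where N: "inverse (real (Suc N)) < \<phi> (f n) - \<phi> u"
        using reals_Archimedean[of "\<phi> (f n) - \<phi> u"] by auto
      \<comment> \<open>Index at least \<open>n\<close> gives constancy of \<open>f\<close>, index
        at least \<open>N\<close> the required tolerance.\<close>
      have "\<phi> (f n) < \<phi> u + inverse (real (Suc (max n N)))"
        using near[OF u(1), of "max n N"] const[of "max n N"] u(2) by simp
      also have "\<dots> \<le> \<phi> u + inverse (real (Suc N))" by (simp add: le_imp_inverse_le)
      finally show False using N by simp
    qed
    then show ?thesis using f(1,2) unfolding minimal_in_def by blast
  next
    \<comment> \<open>Now \<phi> is strictly smaller at \<open>v\<close> than at every
      \<open>f n\<close>, so \<open>v\<close> precedes them all in the strict order too.\<close>
    case False
    then have Rv: "?R v (f n)" for n using v R_iff f(1) by (meson not_le)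
    have "u = v" if u: "u \<in> S" "?R u v" for u
    proof (rule ccontr)
      assume "u \<noteq> v"
      then have "\<phi> u < \<phi> v" using u R_iff v(1) by blast
      then obtain N where N: "inverse (real (Suc N)) < \<phi> v - \<phi> u"
        using reals_Archimedean[of "\<phi> v - \<phi> u"] by auto
      then show False
        using near[OF u(1) R_trans[OF u(2) Rv], of N] decr'[OF v(1) f(1) v(2), of N] by simp
    qed
    then show ?thesis using v(1) R_trans[OF Rv f(2)] unfolding minimal_in_def by blast
  qed
  then obtain v where v: "v \<in> S" "?R v w" "minimal_in ?R S v" by blast
  \<comment> \<open>A predecessor with another first component strictly lowers \<phi>, so it would
    contradict minimality in the strict order.\<close>
  have "fst u = fst v" if u: "u \<in> S" "preceq_H H K u v" for u
  proof (rule ccontr)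
    assume "fst u \<noteq> fst v"
    then have "0 < c * dist (fst u) (fst v)" using c(1) by simp
    then have "\<phi> u < \<phi> v" using decr[OF u(1) v(1) u(2)] by simp
    then have "?R u v" using R_iff u v(1) by blast
    then show False using v(3) u(1) \<open>fst u \<noteq> fst v\<close> unfolding minimal_in_def by blast
  qed
  then show ?thesis using v R_H by blast
qed

section \<open>Assembly of the four cases\<close>

theorem theorem5p8:
  fixes K H :: "'b::hausdorff_tvs set"
    and \<A> :: "('a::metric_space \<times> 'b set) set"
    and \<A>2 :: "'b set set"
    and YA :: "'b set"
  defines "\<A>2 \<equiv> {A. \<exists>x. (x, A) \<in> \<A>}"
    and "YA \<equiv> \<Union> \<A>2"
  assumes K: "proper_convex_cone K"
    and H: "H \<noteq> {}" "H \<subseteq> K - uminus ` K" "convex (H + K)"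
    and \<A>: "\<A> \<noteq> {}" "\<And>x A. (x, A) \<in> \<A> \<Longrightarrow> A \<noteq> {}"
    and complete: "\<And>w :: nat \<Rightarrow> 'a \<times> 'b set.
        (\<And>n. w n \<in> \<A>) \<Longrightarrow> decreasing_seq (preceq_H H K) w \<Longrightarrow> Cauchy (\<lambda>n. fst (w n)) \<Longrightarrow>
        \<exists>v\<in>\<A>. \<forall>n. preceq_H H K v (w n)"
    and cases:
      "((0 \<notin> cl_seq (H + K) \<and> quasi_cone_bounded K YA) \<or>
        (0 \<notin> closure (H + K) \<and> cone_bounded K YA)) \<or>
       (\<exists>z\<in>dual_cone K. inf_over z H > 0 \<and> inf_over z YA > -\<infinity>) \<or>
       ((\<forall>h :: nat \<Rightarrow> 'b. (\<forall>n. h n \<in> H) \<longrightarrow>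
           (\<exists>z\<in>dual_cone K. limsup (\<lambda>n. ereal (z (h n))) > 0)) \<and>
        dual_cone_bounded K YA) \<or>
       (seq_compact H \<and>
        (\<exists>B C. tvs_bounded B \<and> convex_cone C \<and> K \<subseteq> C \<and> H \<subseteq> interior C \<and>
           (\<forall>A\<in>\<A>2. \<not> B \<subseteq> A + C)))"
  shows "(\<forall>w\<in>\<A>. \<exists>v\<in>\<A>. preceq_H H K v w \<and>
            (\<forall>v'\<in>\<A>. preceq_H H K v' v \<longrightarrow> fst v' = fst v)) \<and>
         (\<forall>z\<in>dual_cone K. inf_over z H > 0 \<and> inf_over z YA > -\<infinity> \<longrightarrow>
            (\<forall>w\<in>\<A>. \<exists>v\<in>\<A>. preceq_H H K v w \<and>
               (\<forall>v'\<in>\<A>. preceq_H H K v' v \<longrightarrow> fst v' = fst v) \<and>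
               minimal_in (preceq_Hz H K z) \<A> v \<and> preceq_Hz H K z v w))"
proof -
  have "K \<noteq> {}" "convex_cone K" using K unfolding proper_convex_cone_def convex_cone_iff by auto
  then interpret cone_perturbation K H using H by unfold_locales auto
  have ne: "snd w \<noteq> {}" if "w \<in> \<A>" for w using \<A>(2)[of "fst w" "snd w"] that by simp
  have mem: "snd w \<in> \<A>2" if "w \<in> \<A>" for w
    using that unfolding \<A>2_def by (metis (mono_tags) mem_Collect_eq prod.collapse)
  then have YA: "y \<in> YA" if "w \<in> \<A>" "y \<in> snd w" for w y
    using that unfolding YA_def by blast
  note complete' = complete[unfolded decreasing_seq_def, rule_format]
  \<comment> \<open>Proved for every admissible \<open>z\<close>, this gives the second claim and,
    in case (ii), also the first.\<close>
  have functional: "\<forall>w\<in>\<A>. \<exists>v\<in>\<A>. preceq_H H K v w \<and>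
        (\<forall>v'\<in>\<A>. preceq_H H K v' v \<longrightarrow> fst v' = fst v) \<and>
        minimal_in (preceq_Hz H K z) \<A> v \<and> preceq_Hz H K z v w"
    if z: "z \<in> dual_cone K" "inf_over z H > 0" "inf_over z YA > -\<infinity>" for z
  proof -
    obtain m where m: "ereal m < inf_over z YA" using ereal_dense2[OF z(3)] by blast
    have "m \<le> z y" if "y \<in> YA" for y
      using less_INF_D[OF m[unfolded inf_over_def] that] by simp
    then show ?thesis
      using minimal_of_functional[of K H \<A> z m, OF cone_perturbation_axioms ne complete' z(1,2)] YA
      by blast
  qed
  \<comment> \<open>Case (ii) is split off first, so that only the three other cases have to exclude
    drift.\<close>
  have "\<forall>w\<in>\<A>. \<exists>v\<in>\<A>. preceq_H H K v w \<and> (\<forall>v'\<in>\<A>. preceq_H H K v' v \<longrightarrow> fst v' = fst v)"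
  proof (cases "\<exists>z\<in>dual_cone K. inf_over z H > 0 \<and> inf_over z YA > -\<infinity>")
    case True
    then show ?thesis using functional by blast
  next
    case not_ii: False
    have no_drift: False
      if e: "e > 0" and w: "\<And>n. w n \<in> \<A>" and dec: "\<And>n. preceq_H H K (w (Suc n)) (w n)"
        and far: "\<And>n. e \<le> dist (fst (w (Suc n))) (fst (w n))" for e :: real and w
    proof -
      obtain y where "y \<in> snd (w 0)" using ne[OF w] by blast
      then obtain a h where a: "\<And>n. a n \<in> snd (w n)" and h: "\<And>n. h n \<in> H"
        and chain: "\<And>n. y - a n - e *\<^sub>R (\<Sum>i<n. h i) \<in> K"
        using drift_chain[of w e y, OF dec far] by metis
      have aY: "a n \<in> YA" for n using YA[OF w a] .
      note rest = aY h e chain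
      from cases show False
      proof (elim disjE conjE exE)
        assume "0 \<notin> cl_seq (H + K)" "quasi_cone_bounded K YA"
        then show False
          by (rule no_drift_quasi_cone_bounded[OF cone_perturbation_axioms _ _ rest])
      next
        assume "0 \<notin> closure (H + K)" "cone_bounded K YA"
        then show False
          by (rule no_drift_cone_bounded[OF cone_perturbation_axioms _ _ rest])
      next
        assume "\<exists>z\<in>dual_cone K. inf_over z H > 0 \<and> inf_over z YA > -\<infinity>"
        with not_ii show False by blast
      next
        assume "\<forall>h :: nat \<Rightarrow> 'b. (\<forall>n. h n \<in> H) \<longrightarrow>
            (\<exists>z\<in>dual_cone K. limsup (\<lambda>n. ereal (z (h n))) > 0)"
          and bdd: "dual_cone_bounded K YA"
        then obtain z where z: "z \<in> dual_cone K" "limsup (\<lambda>n. ereal (z (h n))) > 0"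
          using h by blast
        have "bdd_below (z ` YA)" using bdd z(1) unfolding dual_cone_bounded_def by (rule bspec)
        from no_drift_dual_cone_bounded[OF sub z this rest] show False .
      next
        fix B C
        assume 4: "seq_compact H" "tvs_bounded B" "convex_cone C" "K \<subseteq> C" "H \<subseteq> interior C"
          and "\<forall>A\<in>\<A>2. \<not> B \<subseteq> A + C"
        then have "\<not> B \<subseteq> snd (w n) + C" for n using mem[OF w] by blast
        from no_drift_seq_compact[OF sub 4 this a h e chain] show False .
      qed
    qed
    show ?thesis
    proof
      fix w assume w: "w \<in> \<A>"
      show "\<exists>v\<in>\<A>. preceq_H H K v w \<and> (\<forall>v'\<in>\<A>. preceq_H H K v' v \<longrightarrow> fst v' = fst v)"
        by (rule minimal_projection_of_no_drift[where R = "preceq_H H K" and p = fst and S = \<A>])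
          (fact preceq_refl preceq_trans no_drift complete' w)+
    qed
  qed
  then show ?thesis using functional by blast
qed

end
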